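(* Let $\mathbb{X}$ be a normed space and $f_1,f_2:[a,b]\to\mathbb{X}$ be two functions. If $f_1\sim_{x^*}f_2$ for all $x^*\in\mathbb{X}^*\setminus\{0\}$, then $f_1=f_2$.
   Context: Normed spaces are real, and $\mathbb{X}^*$ is the space of bounded linear functionals on $\mathbb{X}$. $[a,b]$ is an order interval $\{t: a\le t\le b\}$ in a real ordered vector space (for instance a closed interval of $\mathbb{R}$). Weak relation: for $x^*\in\mathbb{X}^*\setminus\{0\}$, $f_1\sim_{x^*}f_2$ means $x^*(f_1(t))=x^*(f_2(t))$ for all $t\in[a,b]$. *)

theory Defs
  imports "HOL-Analysis.Bounded_Linear_Function"
begin

text \<open>
  The dual space is the type \<^typ>\<open>'x \<Rightarrow>\<^sub>L real\<close>. A function on the order interval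
  \<open>[a, b]\<close> is a total function of which only the values on \<open>{a..b}\<close> are considered.
\<close>

definition weak_rel ::
  "'v::ordered_real_vector \<Rightarrow> 'v \<Rightarrow> ('x::real_normed_vector \<Rightarrow>\<^sub>L real) \<Rightarrow> ('v \<Rightarrow> 'x) \<Rightarrow> ('v \<Rightarrow> 'x) \<Rightarrow> bool"
  where "weak_rel a b x' f g \<longleftrightarrow> (\<forall>t\<in>{a..b}. blinfun_apply x' (f t) = blinfun_apply x' (g t))"

end

theory Submission
  imports Defs
begin

text \<open>
  If \<open>f1 t \<noteq> f2 t\<close> for some \<open>t\<close>, the vector \<open>x = f1 t - f2 t\<close> is nonzero, and by the
  Hahn--Banach theorem there is a bounded functional that does not vanish at \<open>x\<close>. It is a nonzero
  functional that separates \<open>f1 t\<close> from \<open>f2 t\<close>, which contradicts the weak relation.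

  The Hahn--Banach theorem is obtained through minimal sublinear functionals, which avoids
  extending partial functionals from subspaces. Given a sublinear \<open>p\<close> and a vector \<open>x\<close>, the
  functional \<open>y \<mapsto> inf\<^sub>t (p (y + t x) - t p x)\<close>, with \<open>t\<close> ranging over the nonnegative reals, is
  again sublinear, lies below \<open>p\<close>, and its value at \<open>-x\<close> is at most \<open>- p x\<close> (lemmas
  \<open>sublinear_tilt\<close> and \<open>tilt_le\<close>). This construction is used twice. A minimal sublinear
  functional coincides with all its tilts, which forces it to be additive and hence linear; as
  Zorn's lemma provides minimal elements, every sublinear functional dominates a linear one
  (\<open>linear_below_sublinear\<close>). Applied to the tilt of the norm along \<open>x\<close>, this gives a linear
  functional \<open>f \<le> norm\<close> with \<open>f (-x) \<le> - norm x\<close>, that is, a norming functional for \<open>x\<close>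
  (\<open>norming_functional_exists\<close>).
\<close>

section \<open>Sublinear functionals\<close>

definition sublinear :: "('x::real_vector \<Rightarrow> real) \<Rightarrow> bool" where
  "sublinear p \<longleftrightarrow>
     (\<forall>x y. p (x + y) \<le> p x + p y) \<and> (\<forall>c x. 0 \<le> c \<longrightarrow> p (c *\<^sub>R x) = c * p x)"

text \<open>
  For infima of functionals the inequality for positive scalars is immediate. The converse
  inequality follows by scaling back with \<open>1 / c\<close>. At \<open>0\<close>, scaling by \<open>1 / 2\<close> gives \<open>p 0 \<le> 0\<close>
  and subadditivity gives \<open>p 0 \<ge> 0\<close>.
\<close>

lemma sublinearI:
  assumes add: "\<And>x y. p (x + y) \<le> p x + p y"
    and scale: "\<And>c x. 0 < c \<Longrightarrow> p (c *\<^sub>R x) \<le> c * p x"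
  shows "sublinear p"
proof -
  have "p 0 \<le> 0"
    using scale[of "1/2" 0] by simp
  moreover have "0 \<le> p 0"
    using add[of 0 0] by simp
  ultimately have zero: "p 0 = 0"
    by simp
  have "p (c *\<^sub>R x) = c * p x" if "0 \<le> c" for c x
  proof (cases "c = 0")
    case True
    then show ?thesis by (simp add: zero)
  next
    case False
    with that have c: "0 < c" by simp
    have "p x \<le> inverse c * p (c *\<^sub>R x)"
      using scale[of "inverse c" "c *\<^sub>R x"] c by simp
    then have "c * p x \<le> p (c *\<^sub>R x)"
      using c by (simp add: field_simps)
    with scale[OF c] show ?thesis
      by (simp add: order_antisym)
  qed
  with add show ?thesis
    by (simp add: sublinear_def)
qed

lemma sublinear_add: "sublinear p \<Longrightarrow> p (x + y) \<le> p x + p y"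
  by (simp add: sublinear_def)

lemma sublinear_scale: "sublinear p \<Longrightarrow> 0 \<le> c \<Longrightarrow> p (c *\<^sub>R x) = c * p x"
  by (simp add: sublinear_def)

lemma sublinear_zero: "sublinear p \<Longrightarrow> p 0 = 0"
  using sublinear_scale[of p 0 0] by simp

lemma sublinear_minus: "sublinear p \<Longrightarrow> - p (- x) \<le> p x"
  using sublinear_add[of p x "- x"] sublinear_zero[of p] by simp

lemma sublinear_norm: "sublinear norm"
  by (simp add: sublinear_def norm_triangle_ineq)

text \<open>
  For additive \<open>p\<close> only negative scalars need an argument, and there \<open>p (- x) = - p x\<close> reduces
  to positive ones.
\<close>

lemma linear_if_sublinear_superadditive:
  assumes "sublinear p" and super: "\<And>x y. p x + p y \<le> p (x + y)"
  shows "linear p"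
proof (rule linearI)
  show add: "p (x + y) = p x + p y" for x y
    using sublinear_add[OF assms(1)] super by (simp add: order_antisym)
  have minus: "p (- x) = - p x" for x
    using add[of x "- x"] sublinear_zero[OF assms(1)] by simp
  show "p (c *\<^sub>R x) = c *\<^sub>R p x" for c x
  proof (cases "0 \<le> c")
    case True
    then show ?thesis by (simp add: sublinear_scale[OF assms(1)])
  next
    case False
    then have "p ((- c) *\<^sub>R x) = (- c) * p x"
      by (intro sublinear_scale[OF assms(1)]) simp
    with minus[of "c *\<^sub>R x"] show ?thesis by simp
  qed
qed

section \<open>Tilting a sublinear functional along a vector\<close>

text \<open>
  The tilt is the largest sublinear functional below \<open>p\<close> whose value at \<open>- x\<close> is at most
  \<open>- p x\<close>: it agrees with \<open>p\<close> at \<open>x\<close> and is linear on the line through \<open>x\<close>.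
\<close>

definition tilt :: "('x::real_vector \<Rightarrow> real) \<Rightarrow> 'x \<Rightarrow> 'x \<Rightarrow> real" where
  "tilt p x y = (INF t\<in>{0..}. p (y + t *\<^sub>R x) - t * p x)"

text \<open>The infimum is finite because \<open>t * p x = p (t x) \<le> p (y + t x) + p (- y)\<close>.\<close>

lemma bdd_below_tilt:
  assumes "sublinear p"
  shows "bdd_below ((\<lambda>t. p (y + t *\<^sub>R x) - t * p x) ` {0..})"
proof (rule bdd_belowI2)
  fix t :: real
  assume "t \<in> {0..}"
  then have "t * p x = p ((y + t *\<^sub>R x) + - y)"
    by (simp add: sublinear_scale[OF assms])
  also have "\<dots> \<le> p (y + t *\<^sub>R x) + p (- y)"
    by (rule sublinear_add[OF assms])
  finally show "- p (- y) \<le> p (y + t *\<^sub>R x) - t * p x"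
    by simp
qed

lemma tilt_le:
  assumes "sublinear p" "0 \<le> t"
  shows "tilt p x y \<le> p (y + t *\<^sub>R x) - t * p x"
  unfolding tilt_def using assms by (intro cINF_lower bdd_below_tilt) auto

lemma tilt_greatest:
  assumes "\<And>t. 0 \<le> t \<Longrightarrow> m \<le> p (y + t *\<^sub>R x) - t * p x"
  shows "m \<le> tilt p x y"
  unfolding tilt_def using assms by (intro cINF_greatest) auto

lemma tilt_below: "sublinear p \<Longrightarrow> tilt p x \<le> p"
  using tilt_le[of p 0 x] by (simp add: le_fun_def)

text \<open>
  Both properties come from reparametrising the infimum: parameters \<open>s\<close> for \<open>y\<close> and \<open>t\<close> for
  \<open>z\<close> yield the parameter \<open>s + t\<close> for \<open>y + z\<close>, and \<open>t\<close> for \<open>y\<close> yields \<open>c t\<close> for \<open>c y\<close>.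
\<close>

lemma sublinear_tilt:
  assumes p: "sublinear p"
  shows "sublinear (tilt p x)"
proof (rule sublinearI)
  fix y z
  have bound: "tilt p x (y + z) \<le> (p (y + s *\<^sub>R x) - s * p x) + (p (z + t *\<^sub>R x) - t * p x)"
    if "0 \<le> s" "0 \<le> t" for s t
  proof -
    have "tilt p x (y + z) \<le> p ((y + z) + (s + t) *\<^sub>R x) - (s + t) * p x"
      using that by (intro tilt_le[OF p]) simp
    moreover have "(y + z) + (s + t) *\<^sub>R x = (y + s *\<^sub>R x) + (z + t *\<^sub>R x)"
      by (simp add: algebra_simps)
    ultimately show ?thesis
      using sublinear_add[OF p, of "y + s *\<^sub>R x" "z + t *\<^sub>R x"] by (simp add: algebra_simps)
  qed
  have "tilt p x (y + z) - (p (y + s *\<^sub>R x) - s * p x) \<le> tilt p x z" if "0 \<le> s" for s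
    by (rule tilt_greatest) (use bound[OF that] in \<open>simp add: algebra_simps\<close>)
  then have "tilt p x (y + z) - tilt p x z \<le> tilt p x y"
    by (intro tilt_greatest) (simp add: algebra_simps)
  then show "tilt p x (y + z) \<le> tilt p x y + tilt p x z"
    by simp
next
  fix c :: real and y
  assume c: "0 < c"
  have "tilt p x (c *\<^sub>R y) / c \<le> tilt p x y"
  proof (rule tilt_greatest)
    fix t :: real
    assume "0 \<le> t"
    with c have "tilt p x (c *\<^sub>R y) \<le> p (c *\<^sub>R y + (c * t) *\<^sub>R x) - (c * t) * p x"
      by (intro tilt_le[OF p]) simp
    also have "c *\<^sub>R y + (c * t) *\<^sub>R x = c *\<^sub>R (y + t *\<^sub>R x)"
      by (simp add: scaleR_add_right)
    also have "p \<dots> - (c * t) * p x = c * (p (y + t *\<^sub>R x) - t * p x)"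
      using c sublinear_scale[OF p, of c "y + t *\<^sub>R x"] by (simp add: right_diff_distrib)
    finally show "tilt p x (c *\<^sub>R y) / c \<le> p (y + t *\<^sub>R x) - t * p x"
      using c by (simp add: divide_le_eq mult.commute)
  qed
  then show "tilt p x (c *\<^sub>R y) \<le> c * tilt p x y"
    using c by (simp add: divide_le_eq mult.commute)
qed

text \<open>
  If \<open>q\<close> equals its tilt along \<open>x\<close>, the parameter \<open>t = 1\<close> in the infimum gives
  \<open>q y \<le> q (y + x) - q x\<close>.
\<close>

lemma minimal_sublinear_is_linear:
  assumes q: "sublinear q" and minimal: "\<And>r. sublinear r \<Longrightarrow> r \<le> q \<Longrightarrow> r = q"
  shows "linear q"
proof (rule linear_if_sublinear_superadditive[OF q])
  fix x y
  have "tilt q x = q"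
    by (intro minimal sublinear_tilt tilt_below q)
  then show "q x + q y \<le> q (x + y)"
    using tilt_le[OF q, of 1 x y] by (simp add: add.commute)
qed

section \<open>The Hahn--Banach theorem\<close>

text \<open>
  Subadditivity of the infimum needs the chain condition: for \<open>q\<close> and \<open>r\<close> in the chain, the
  smaller of the two is subadditive and bounded by \<open>q\<close> at one vector and by \<open>r\<close> at the other.
\<close>

lemma sublinear_INF_chain:
  fixes C :: "('x::real_vector \<Rightarrow> real) set"
  assumes ne: "C \<noteq> {}"
    and sub: "\<And>q. q \<in> C \<Longrightarrow> sublinear q"
    and chain: "\<And>q r. q \<in> C \<Longrightarrow> r \<in> C \<Longrightarrow> q \<le> r \<or> r \<le> q"
    and bdd: "\<And>y. bdd_below ((\<lambda>q. q y) ` C)"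
  shows "sublinear (\<lambda>y. INF q\<in>C. q y)"
proof (rule sublinearI)
  let ?i = "\<lambda>y. INF q\<in>C. q y"
  have lower: "?i y \<le> q y" if "q \<in> C" for q y
    by (rule cINF_lower[OF bdd that])
  fix y z
  have bound: "?i (y + z) \<le> q y + r z" if "q \<in> C" "r \<in> C" for q r
  proof -
    obtain s where s: "s \<in> C" "s \<le> q" "s \<le> r"
      using chain[of q r] \<open>q \<in> C\<close> \<open>r \<in> C\<close> by blast
    have "?i (y + z) \<le> s y + s z"
      using lower[OF s(1)] sublinear_add[OF sub[OF s(1)]] by (rule order_trans)
    also have "\<dots> \<le> q y + r z"
      using s by (intro add_mono) (simp_all add: le_fun_def)
    finally show ?thesis .
  qed
  have "?i (y + z) - q y \<le> ?i z" if "q \<in> C" for q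
    by (rule cINF_greatest[OF ne]) (use bound[OF that] in \<open>simp add: algebra_simps\<close>)
  then have "?i (y + z) - ?i z \<le> ?i y"
    by (intro cINF_greatest[OF ne]) (simp add: algebra_simps)
  then show "?i (y + z) \<le> ?i y + ?i z"
    by simp
next
  let ?i = "\<lambda>y. INF q\<in>C. q y"
  fix c :: real and y
  assume c: "0 < c"
  have "?i (c *\<^sub>R y) / c \<le> ?i y"
  proof (rule cINF_greatest[OF ne])
    fix q
    assume "q \<in> C"
    then have "?i (c *\<^sub>R y) \<le> q (c *\<^sub>R y)"
      by (rule cINF_lower[OF bdd])
    then show "?i (c *\<^sub>R y) / c \<le> q y"
      using c sublinear_scale[OF sub[OF \<open>q \<in> C\<close>]] by (simp add: divide_le_eq mult.commute)
  qed
  then show "?i (c *\<^sub>R y) \<le> c * ?i y"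
    using c by (simp add: divide_le_eq mult.commute)
qed

text \<open>
  Zorn's lemma applies because a chain of sublinear functionals below \<open>p\<close> is pointwise bounded
  below: \<open>q y \<ge> - q (- y) \<ge> - p (- y)\<close>.
\<close>

lemma minimal_sublinear_exists:
  fixes p :: "'x::real_vector \<Rightarrow> real"
  assumes p: "sublinear p"
  obtains q where "sublinear q" "q \<le> p" "\<And>r. sublinear r \<Longrightarrow> r \<le> q \<Longrightarrow> r = q"
proof -
  let ?A = "{q. sublinear q \<and> q \<le> p}"
  have "\<exists>m\<in>?A. \<forall>r\<in>?A. r \<le> m \<longrightarrow> r = m"
  proof (rule predicate_Zorn)
    show "partial_order_on ?A (relation_of (\<lambda>q r. r \<le> q) ?A)"
      by (rule partial_order_on_relation_ofI) auto
  next
    fix C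
    assume C: "C \<in> Chains (relation_of (\<lambda>q r. r \<le> q) ?A)"
    then have sub: "C \<subseteq> ?A" and chain: "\<And>q r. q \<in> C \<Longrightarrow> r \<in> C \<Longrightarrow> q \<le> r \<or> r \<le> q"
      by (auto simp: Chains_def relation_of_def)
    show "\<exists>u\<in>?A. \<forall>q\<in>C. u \<le> q"
    proof (cases "C = {}")
      case True
      with p show ?thesis by auto
    next
      case False
      have bdd: "bdd_below ((\<lambda>q. q y) ` C)" for y
      proof (rule bdd_belowI2)
        fix q
        assume "q \<in> C"
        with sub have q: "sublinear q" "q \<le> p" by auto
        show "- p (- y) \<le> q y"
          using sublinear_minus[OF q(1), of y] le_funD[OF q(2), of "- y"] by simp
      qed
      let ?i = "\<lambda>y. INF q\<in>C. q y"
      have lower: "?i \<le> q" if "q \<in> C" for q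
        by (rule le_funI) (rule cINF_lower[OF bdd that])
      have "sublinear ?i"
        using sub by (intro sublinear_INF_chain False chain bdd) auto
      moreover have "?i \<le> p"
      proof -
        from False obtain q where "q \<in> C" by blast
        with lower sub show ?thesis by (blast intro: order_trans)
      qed
      ultimately show ?thesis
        using lower by (intro bexI[of _ ?i]) auto
    qed
  qed
  then show thesis
    using that by (auto intro: order_trans)
qed

lemma linear_below_sublinear:
  fixes p :: "'x::real_vector \<Rightarrow> real"
  assumes "sublinear p"
  obtains f where "linear f" "f \<le> p"
  using minimal_sublinear_exists[OF assms] minimal_sublinear_is_linear by metis

text \<open>
  A linear \<open>f\<close> below the tilt of the norm along \<open>x\<close> satisfies \<open>f \<le> norm\<close>, hence has norm at
  most \<open>1\<close>, and \<open>f (- x) \<le> - norm x\<close>, hence \<open>f x \<ge> norm x\<close>.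
\<close>

theorem norming_functional_exists:
  fixes x :: "'x::real_normed_vector"
  obtains f :: "'x \<Rightarrow>\<^sub>L real" where "norm f \<le> 1" "blinfun_apply f x = norm x"
proof -
  obtain g where g: "linear g" "g \<le> tilt norm x"
    using linear_below_sublinear[OF sublinear_tilt[OF sublinear_norm]] .
  have below: "g y \<le> norm y" for y
    using order_trans[OF g(2) tilt_below[OF sublinear_norm]] by (rule le_funD)
  have abs: "\<bar>g y\<bar> \<le> norm y" for y
    using below[of y] below[of "- y"] by (simp add: linear_neg[OF g(1)] abs_le_iff)
  have "bounded_linear g"
    using g(1) abs
    by (intro bounded_linear_intro[where K = 1]) (simp_all add: linear_add linear_scale)
  then have g_apply: "blinfun_apply (Blinfun g) = g"
    by (rule bounded_linear_Blinfun_apply)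
  have "g (- x) \<le> - norm x"
    using le_funD[OF g(2), of "- x"] tilt_le[OF sublinear_norm, of 1 x "- x"] by simp
  then have "g x = norm x"
    using below[of x] by (simp add: linear_neg[OF g(1)])
  moreover have "norm (Blinfun g) \<le> 1"
    by (rule norm_blinfun_bound) (simp_all add: g_apply abs)
  ultimately show thesis
    using that g_apply by metis
qed

section \<open>Functions that agree weakly\<close>

theorem proposition3p14:
  fixes a b :: "'v::ordered_real_vector"
    and f1 f2 :: "'v \<Rightarrow> 'x::real_normed_vector"
  assumes "\<And>x' :: 'x \<Rightarrow>\<^sub>L real. x' \<noteq> 0 \<Longrightarrow> weak_rel a b x' f1 f2"
  shows "\<forall>t\<in>{a..b}. f1 t = f2 t"
proof (rule ballI, rule ccontr)
  fix t
  assume t: "t \<in> {a..b}" and ne: "f1 t \<noteq> f2 t"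
  obtain f :: "'x \<Rightarrow>\<^sub>L real" where f: "blinfun_apply f (f1 t - f2 t) = norm (f1 t - f2 t)"
    by (rule norming_functional_exists)
  with ne have "f \<noteq> 0"
    by auto
  then have "blinfun_apply f (f1 t) = blinfun_apply f (f2 t)"
    using assms t by (simp add: weak_rel_def)
  with f ne show False
    by (simp add: blinfun.diff_right)
qed

end
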